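(* Let $P$ and $Q$ be finite graded posets and let $f:P\to Q$ be a surjective rank-preserving poset map. Assume that for every $q\in Q$ the fiber $f^{-1}(\langle q\rangle)$ is strongly constructible. If $Q$ is strongly constructible, then so is $P$.
   Context: A poset is graded if all its maximal chains have the same length (its rank); ranks of elements are lengths of maximal chains below them, and a rank-preserving map preserves ranks of elements. $\langle q\rangle=\{q'\in Q: q'\le q\}$. A poset is bounded if it has a minimum and a maximum; it is (pure) shellable if its order complex (simplicial complex of chains) is pure and shellable, i.e. its facets admit an order $F_1,\dots,F_m$ such that for each $i\ge2$ the intersection of the simplex on $F_i$ with the complex generated by $F_1,\dots,F_{i-1}$ is generated by a nonempty set of maximal proper faces of $F_i$. A graded poset $P$ of rank $n$ with a minimum element is strongly constructible if either (i) $P$ is bounded and pure shellable, or (ii) $P$ is the union of two strongly constructible proper order ideals $J_1,J_2$ of rank $n$ such that $J_1\cap J_2$ is a strongly constructible poset of rank at least $n-1$. *)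

theory Defs
  imports Main
begin

text \<open>
  A poset is a subset \<open>P\<close> of a type of class \<open>order\<close>, with the induced order;
  subposets and order ideals are then subsets.  A simplicial complex is the set of its faces,
  the empty face included.
\<close>

definition poset_chains :: "'a::order set \<Rightarrow> 'a set set" where
  "poset_chains P = {C. C \<subseteq> P \<and> Complete_Partial_Order.chain (\<le>) C}"

definition facets :: "'a set set \<Rightarrow> 'a set set" where
  "facets K = {F \<in> K. \<forall>G \<in> K. F \<subseteq> G \<longrightarrow> F = G}"

definition maximal_chains :: "'a::order set \<Rightarrow> 'a set set" where
  "maximal_chains P = facets (poset_chains P)"

definition chain_length :: "'a set \<Rightarrow> int" where
  "chain_length C = int (card C) - 1"

definition graded_poset :: "'a::order set \<Rightarrow> bool" where
  "graded_poset P \<longleftrightarrow> (\<exists>r. \<forall>C \<in> maximal_chains P. finite C \<and> chain_length C = r)"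

text \<open>Only meaningful for graded \<open>P\<close>; the empty poset has rank \<open>-1\<close>.\<close>

definition poset_rank :: "'a::order set \<Rightarrow> int" where
  "poset_rank P = (THE r. \<forall>C \<in> maximal_chains P. chain_length C = r)"

definition principal_ideal :: "'a::order set \<Rightarrow> 'a \<Rightarrow> 'a set" where
  "principal_ideal P x = {y \<in> P. y \<le> x}"

definition element_rank :: "'a::order set \<Rightarrow> 'a \<Rightarrow> int" where
  "element_rank P x = poset_rank (principal_ideal P x)"

definition order_ideal :: "'a::order set \<Rightarrow> 'a set \<Rightarrow> bool" where
  "order_ideal P J \<longleftrightarrow> J \<subseteq> P \<and> (\<forall>x \<in> J. \<forall>y \<in> P. y \<le> x \<longrightarrow> y \<in> J)"

definition has_minimum :: "'a::order set \<Rightarrow> bool" where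
  "has_minimum P \<longleftrightarrow> (\<exists>m \<in> P. \<forall>x \<in> P. m \<le> x)"

definition has_maximum :: "'a::order set \<Rightarrow> bool" where
  "has_maximum P \<longleftrightarrow> (\<exists>m \<in> P. \<forall>x \<in> P. x \<le> m)"

definition bounded_poset :: "'a::order set \<Rightarrow> bool" where
  "bounded_poset P \<longleftrightarrow> has_minimum P \<and> has_maximum P"

definition order_complex :: "'a::order set \<Rightarrow> 'a set set" where
  "order_complex P = {C \<in> poset_chains P. finite C}"

definition generated_complex :: "'a set set \<Rightarrow> 'a set set" where
  "generated_complex S = (\<Union>F \<in> S. Pow F)"

definition maximal_proper_faces :: "'a set \<Rightarrow> 'a set set" where
  "maximal_proper_faces F = {F - {v} | v. v \<in> F}"

definition pure_complex :: "'a set set \<Rightarrow> bool" where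
  "pure_complex K \<longleftrightarrow> (\<forall>F \<in> facets K. \<forall>G \<in> facets K. card F = card G)"

definition shelling :: "'a set set \<Rightarrow> 'a set list \<Rightarrow> bool" where
  "shelling K Fs \<longleftrightarrow> distinct Fs \<and> set Fs = facets K \<and>
    (\<forall>i. 1 \<le> i \<and> i < length Fs \<longrightarrow>
      (\<exists>S. S \<noteq> {} \<and> S \<subseteq> maximal_proper_faces (Fs ! i) \<and>
        Pow (Fs ! i) \<inter> generated_complex (set (take i Fs)) = generated_complex S))"

definition shellable_complex :: "'a set set \<Rightarrow> bool" where
  "shellable_complex K \<longleftrightarrow> (\<exists>Fs. shelling K Fs)"

definition pure_shellable_poset :: "'a::order set \<Rightarrow> bool" where
  "pure_shellable_poset P \<longleftrightarrow>
    pure_complex (order_complex P) \<and> shellable_complex (order_complex P)"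

inductive strongly_constructible :: "'a::order set \<Rightarrow> bool" where
  bounded_shellable:
    "\<lbrakk>graded_poset P; has_minimum P; bounded_poset P; pure_shellable_poset P\<rbrakk>
      \<Longrightarrow> strongly_constructible P"
| ideal_union:
    "\<lbrakk>graded_poset P; has_minimum P;
      order_ideal P J1; J1 \<noteq> P; strongly_constructible J1; poset_rank J1 = poset_rank P;
      order_ideal P J2; J2 \<noteq> P; strongly_constructible J2; poset_rank J2 = poset_rank P;
      P = J1 \<union> J2;
      strongly_constructible (J1 \<inter> J2); poset_rank (J1 \<inter> J2) \<ge> poset_rank P - 1\<rbrakk>
      \<Longrightarrow> strongly_constructible P"

definition rank_preserving :: "'a::order set \<Rightarrow> 'b::order set \<Rightarrow> ('a \<Rightarrow> 'b) \<Rightarrow> bool" where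
  "rank_preserving P Q f \<longleftrightarrow> (\<forall>x \<in> P. element_rank Q (f x) = element_rank P x)"

end

theory Submission imports Defs begin

text \<open>
  Induct on the strong constructibility of \<open>Q\<close>.  If \<open>Q\<close> has a maximum, then \<open>P\<close> itself is a fiber.
  If \<open>Q = J1 \<union> J2\<close>, then \<open>P\<close> is the union of the preimages of \<open>J1\<close> and \<open>J2\<close>, which meet in the
  preimage of \<open>J1 \<inter> J2\<close>; what must be checked is that these preimages are graded of the same ranks
  as the ideals.  If \<open>x\<close> is maximal in the preimage of \<open>J\<close> and \<open>q\<close> is a maximal element of \<open>J\<close>
  above \<open>f x\<close>, then the fiber over \<open>q\<close> is graded and has both \<open>x\<close> and a preimage of \<open>q\<close> among its
  maximal elements, so \<open>x\<close> and \<open>q\<close> have equal rank.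
\<close>

section \<open>Maximal chains and rank in finite posets\<close>

lemma maximal_chains_iff:
  "C \<in> maximal_chains P \<longleftrightarrow> C \<subseteq> P \<and> (\<forall>x\<in>C. \<forall>y\<in>C. x \<le> y \<or> y \<le> x) \<and>
    (\<forall>z\<in>P. (\<forall>y\<in>C. z \<le> y \<or> y \<le> z) \<longrightarrow> z \<in> C)"
  (is "?L \<longleftrightarrow> ?R")
proof
  assume L: ?L
  then have C: "C \<subseteq> P" "\<forall>x\<in>C. \<forall>y\<in>C. x \<le> y \<or> y \<le> x"
    by (auto simp: maximal_chains_def facets_def poset_chains_def chain_def)
  have "z \<in> C" if "z \<in> P" "\<forall>y\<in>C. z \<le> y \<or> y \<le> z" for z
  proof -
    \<comment> \<open>An element comparable with all of \<open>C\<close> extends it to a chain, so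
      maximality can be tested one element at a time.\<close>
    have "insert z C \<in> poset_chains P"
      using C that by (auto simp: poset_chains_def chain_def)
    then have "C = insert z C"
      using L unfolding maximal_chains_def facets_def by blast
    then show ?thesis by blast
  qed
  with C show ?R by blast
next
  assume ?R
  then show ?L
    unfolding maximal_chains_def facets_def poset_chains_def chain_def by blast
qed

lemma maximal_chain_extending:
  assumes "finite P" "C \<subseteq> P" "\<And>x y. x \<in> C \<Longrightarrow> y \<in> C \<Longrightarrow> x \<le> y \<or> y \<le> x"
  obtains M where "M \<in> maximal_chains P" "C \<subseteq> M"
proof -
  have "finite (poset_chains P)"
    using assms(1) by (rule_tac finite_subset[of _ "Pow P"]) (auto simp: poset_chains_def)
  moreover have "C \<in> poset_chains P"
    using assms by (auto simp: poset_chains_def chain_def)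
  ultimately obtain M where "M \<in> poset_chains P" "C \<subseteq> M"
    "\<forall>G\<in>poset_chains P. M \<subseteq> G \<longrightarrow> M = G"
    using finite_has_maximal2[of "poset_chains P" C] by blast
  then show thesis
    using that by (auto simp: maximal_chains_def facets_def)
qed

lemma poset_rank_eqI:
  assumes "finite P" "\<And>C. C \<in> maximal_chains P \<Longrightarrow> chain_length C = r"
  shows "poset_rank P = r"
  unfolding poset_rank_def
proof (rule the_equality)
  show "\<forall>C\<in>maximal_chains P. chain_length C = r" using assms(2) by blast
  \<comment> \<open>The empty chain extends to a maximal chain, so the condition on \<open>s\<close>
    is not vacuous and fixes its value.\<close>
  show "s = r" if "\<forall>C\<in>maximal_chains P. chain_length C = s" for s
    using maximal_chain_extending[OF assms(1), of "{}"] that assms(2)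
    by (metis empty_iff empty_subsetI)
qed

lemma chain_length_eq_poset_rank:
  assumes "finite P" "graded_poset P" "C \<in> maximal_chains P"
  shows "chain_length C = poset_rank P"
proof -
  obtain r where "\<forall>C\<in>maximal_chains P. chain_length C = r"
    using assms(2) unfolding graded_poset_def by blast
  then show ?thesis
    using poset_rank_eqI[OF assms(1)] assms(3) by metis
qed

lemma graded_posetI:
  assumes "finite P" "\<And>C. C \<in> maximal_chains P \<Longrightarrow> chain_length C = r"
  shows "graded_poset P"
proof -
  have "finite C" if "C \<in> maximal_chains P" for C
    using that assms(1) finite_subset by (auto simp: maximal_chains_iff)
  then show ?thesis using assms(2) unfolding graded_poset_def by blast
qed

section \<open>Principal ideals and ranks of elements\<close>

lemma finite_principal_ideal: "finite P \<Longrightarrow> finite (principal_ideal P x)"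
  by (simp add: principal_ideal_def)

text \<open>The part of a maximal chain above \<open>x\<close> completes any two maximal chains of the principal
  ideal of \<open>x\<close>.\<close>

lemma graded_principal_ideal:
  assumes "finite P" "graded_poset P" "x \<in> P"
  shows "graded_poset (principal_ideal P x)"
proof -
  let ?I = "principal_ideal P x"
  obtain M where M: "M \<in> maximal_chains P" "{x} \<subseteq> M"
    using maximal_chain_extending[OF assms(1), of "{x}"] assms(3) by blast
  \<comment> \<open>\<open>U\<close> depends on \<open>M\<close> and \<open>x\<close> only, so once
    \<open>D \<union> U\<close> is a maximal chain of \<open>P\<close> for every \<open>D\<close>,
    all these \<open>D\<close> have the same length.\<close>
  define U where "U = {y \<in> M. x < y}"
  have "chain_length D = poset_rank P - int (card U)" if D: "D \<in> maximal_chains ?I" for D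
  proof -
    have "x \<in> D" and Dx: "\<And>d. d \<in> D \<Longrightarrow> d \<le> x" and DP: "D \<subseteq> P"
      using D assms(3) by (auto simp: maximal_chains_iff principal_ideal_def)
    have "D \<union> U \<in> maximal_chains P"
      unfolding maximal_chains_iff
    proof (intro conjI ballI impI)
      show "D \<union> U \<subseteq> P"
        using DP M(1) by (auto simp: maximal_chains_iff U_def)
    next
      fix a b assume "a \<in> D \<union> U" "b \<in> D \<union> U"
      moreover have "a \<le> b \<or> b \<le> a" if "a \<in> D" "b \<in> D" for a b
        using that D by (auto simp: maximal_chains_iff)
      moreover have "a \<le> b \<or> b \<le> a" if "a \<in> U" "b \<in> U" for a b
        using that M(1) by (auto simp: maximal_chains_iff U_def)
      moreover have "a \<le> b" if "a \<in> D" "b \<in> U" for a b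
        using that Dx[of a] by (auto simp: U_def)
      ultimately show "a \<le> b \<or> b \<le> a" by blast
    next
      fix z assume z: "z \<in> P" "\<forall>y\<in>D \<union> U. z \<le> y \<or> y \<le> z"
      show "z \<in> D \<union> U"
      proof (cases "z \<le> x")
        case True
        then have "z \<in> D"
          using D z by (auto simp: maximal_chains_iff principal_ideal_def)
        then show ?thesis by blast
      next
        case False
        then have xz: "x < z"
          using z \<open>x \<in> D\<close> by auto
        \<comment> \<open>Elements of \<open>M\<close> are comparable with \<open>x\<close>, so they
          lie below \<open>x\<close>, hence below \<open>z\<close>, or in \<open>U\<close>, where
          \<open>z\<close> is comparable by assumption.\<close>
        have "z \<le> y \<or> y \<le> z" if "y \<in> M" for y
        proof -
          have "y \<le> x \<or> y \<in> U"
            using M that by (auto simp: maximal_chains_iff U_def less_le)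
          then show ?thesis using xz z by auto
        qed
        then have "z \<in> M" using M z by (auto simp: maximal_chains_iff)
        then show ?thesis using xz by (auto simp: U_def)
      qed
    qed
    then have "chain_length (D \<union> U) = poset_rank P"
      using chain_length_eq_poset_rank assms by blast
    moreover have "card (D \<union> U) = card D + card U"
    proof (rule card_Un_disjoint)
      show "finite D" using DP assms(1) finite_subset by blast
      show "finite U"
        using M(1) assms(1) finite_subset[of M P] by (auto simp: maximal_chains_iff U_def)
      show "D \<inter> U = {}" using Dx by (force simp: U_def)
    qed
    ultimately show ?thesis by (simp add: chain_length_def)
  qed
  then show ?thesis
    using graded_posetI finite_principal_ideal[OF assms(1)] by blast
qed

text \<open>This makes \<open>element_rank\<close> in an order ideal agree with
  \<open>element_rank\<close> in the whole poset, so ranks can be compared across fibers, preimages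
  and \<open>P\<close>.\<close>

lemma principal_ideal_order_ideal:
  "order_ideal P J \<Longrightarrow> x \<in> J \<Longrightarrow> principal_ideal J x = principal_ideal P x"
  by (auto simp: order_ideal_def principal_ideal_def)

text \<open>A maximal chain below a maximal element \<open>x\<close> contains \<open>x\<close>, and
  whatever is comparable with \<open>x\<close> in \<open>P\<close> lies below it; so the chain is
  maximal in \<open>P\<close> too.\<close>

lemma element_rank_maximal:
  assumes "finite P" "graded_poset P" "x \<in> P" "\<And>y. y \<in> P \<Longrightarrow> x \<le> y \<Longrightarrow> y = x"
  shows "element_rank P x = poset_rank P"
  unfolding element_rank_def
proof (rule poset_rank_eqI[OF finite_principal_ideal[OF assms(1)]])
  fix C assume C: "C \<in> maximal_chains (principal_ideal P x)"
  have "x \<in> C"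
    using C assms(3) by (auto simp: maximal_chains_iff principal_ideal_def)
  have "C \<in> maximal_chains P"
    unfolding maximal_chains_iff
  proof (intro conjI ballI impI)
    show "C \<subseteq> P" using C by (auto simp: maximal_chains_iff principal_ideal_def)
    show "a \<le> b \<or> b \<le> a" if "a \<in> C" "b \<in> C" for a b
      using C that by (auto simp: maximal_chains_iff)
    show "z \<in> C" if z: "z \<in> P" "\<forall>y\<in>C. z \<le> y \<or> y \<le> z" for z
    proof -
      have "z \<le> x" using z \<open>x \<in> C\<close> assms(4) by blast
      then show ?thesis using z C by (auto simp: maximal_chains_iff principal_ideal_def)
    qed
  qed
  then show "chain_length C = poset_rank P"
    using chain_length_eq_poset_rank assms by blast
qed

text \<open>The top of \<open>C\<close> is a maximal element of \<open>P\<close>, and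
  \<open>C\<close> is a maximal chain of its principal ideal. Gradedness of \<open>P\<close> thus
  reduces to that of its principal ideals and to equal ranks of its maximal elements.\<close>

lemma chain_length_maximal_element:
  assumes "finite P" "P \<noteq> {}" "C \<in> maximal_chains P"
    and "\<And>x. x \<in> P \<Longrightarrow> graded_poset (principal_ideal P x)"
    and "\<And>x. x \<in> P \<Longrightarrow> (\<And>y. y \<in> P \<Longrightarrow> x \<le> y \<Longrightarrow> y = x) \<Longrightarrow> element_rank P x = r"
  shows "chain_length C = r"
proof -
  have "finite C" "C \<subseteq> P"
    using assms(1,3) finite_subset by (auto simp: maximal_chains_iff)
  moreover have "C \<noteq> {}" using assms(2,3) by (auto simp: maximal_chains_iff)
  ultimately obtain x where x: "x \<in> C" "\<And>y. y \<in> C \<Longrightarrow> x \<le> y \<Longrightarrow> x = y"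
    using finite_has_maximal[of C] by metis
  have below: "y \<le> x" if "y \<in> C" for y
    using that x assms(3) by (fastforce simp: maximal_chains_iff)
  have "y = x" if y: "y \<in> P" "x \<le> y" for y
  proof -
    have "y \<in> C" using assms(3) y below by (force simp: maximal_chains_iff)
    then show ?thesis using x y by blast
  qed
  then have "element_rank P x = r" using assms(5) x \<open>C \<subseteq> P\<close> by blast
  moreover have "C \<in> maximal_chains (principal_ideal P x)"
    using assms(3) below by (auto simp: maximal_chains_iff principal_ideal_def)
  ultimately show ?thesis
    using chain_length_eq_poset_rank[of "principal_ideal P x" C] assms(1,4) x \<open>C \<subseteq> P\<close>
    by (auto simp: element_rank_def finite_principal_ideal)
qed

text \<open>Minimality becomes a condition on ranks, which passes along rank-preserving
  maps.\<close>

lemma element_rank_eq_0_iff: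
  assumes "finite P" "graded_poset P" "x \<in> P"
  shows "element_rank P x = 0 \<longleftrightarrow> (\<forall>y\<in>P. y \<le> x \<longrightarrow> y = x)"
proof
  let ?I = "principal_ideal P x"
  have fin: "finite ?I" by (rule finite_principal_ideal[OF assms(1)])
  show "element_rank P x = 0" if "\<forall>y\<in>P. y \<le> x \<longrightarrow> y = x"
  proof -
    have "?I = {x}" using that assms(3) by (auto simp: principal_ideal_def)
    then have "chain_length C = 0" if "C \<in> maximal_chains ?I" for C
    proof -
      have "C = {x}" using that \<open>?I = {x}\<close> by (auto simp: maximal_chains_iff)
      then show ?thesis by (simp add: chain_length_def)
    qed
    then show ?thesis
      unfolding element_rank_def using poset_rank_eqI[OF fin] by blast
  qed
  show "\<forall>y\<in>P. y \<le> x \<longrightarrow> y = x" if r: "element_rank P x = 0"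
  proof (intro ballI impI)
    fix y assume y: "y \<in> P" "y \<le> x"
    \<comment> \<open>A maximal chain through \<open>y\<close> and \<open>x\<close> has length 0,
      that is, a single element.\<close>
    obtain M where M: "M \<in> maximal_chains ?I" "{y, x} \<subseteq> M"
    proof (rule maximal_chain_extending[OF fin])
      show "{y, x} \<subseteq> ?I" using y assms(3) by (auto simp: principal_ideal_def)
    qed (use y in auto)
    have "chain_length M = 0"
      using chain_length_eq_poset_rank[OF fin graded_principal_ideal[OF assms] M(1)] r
      by (simp add: element_rank_def)
    then have "card M = 1" by (simp add: chain_length_def)
    then show "y = x" using M(2) by (auto simp: card_1_singleton_iff)
  qed
qed

section \<open>Strong constructibility and preimages of order ideals\<close>

lemma strongly_constructible_graded: "strongly_constructible P \<Longrightarrow> graded_poset P"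
  by (auto elim: strongly_constructible.cases)

lemma strongly_constructible_has_minimum: "strongly_constructible P \<Longrightarrow> has_minimum P"
  by (auto elim: strongly_constructible.cases)

lemma order_ideal_vimage:
  assumes "mono_on P f" "f ` P = Q" "order_ideal Q J"
  shows "order_ideal P (P \<inter> f -` J)"
  unfolding order_ideal_def
proof (intro conjI ballI impI)
  fix x y assume "x \<in> P \<inter> f -` J" "y \<in> P" "y \<le> x"
  then show "y \<in> P \<inter> f -` J"
    using assms mono_onD[OF assms(1), of y x] by (auto simp: order_ideal_def)
qed blast

text \<open>Serves the ideals of a decomposition of \<open>Q\<close>, and the case
  \<open>J = Q\<close>, where it compares the ranks of \<open>P\<close> and
  \<open>Q\<close>.\<close>

lemma vimage_order_ideal_rank:
  fixes P :: "'a::order set" and Q :: "'b::order set"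
  assumes P: "finite P" "graded_poset P" and Q: "finite Q"
    and f: "mono_on P f" "f ` P = Q" "rank_preserving P Q f"
    and fib: "\<And>q. q \<in> Q \<Longrightarrow> graded_poset (P \<inter> f -` principal_ideal Q q)"
    and J: "order_ideal Q J" "graded_poset J" "J \<noteq> {}"
  shows "graded_poset (P \<inter> f -` J)" "poset_rank (P \<inter> f -` J) = poset_rank J"
proof -
  let ?R = "P \<inter> f -` J"
  have JQ: "J \<subseteq> Q" using J by (simp add: order_ideal_def)
  have finJ: "finite J" using JQ Q finite_subset by blast
  have R: "finite ?R" "order_ideal P ?R" "?R \<noteq> {}"
    using P order_ideal_vimage[OF f(1,2) J(1)] J(3) JQ f(2) by auto
  have length: "chain_length C = poset_rank J" if "C \<in> maximal_chains ?R" for C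
  proof (rule chain_length_maximal_element[OF R(1) R(3) that])
    show "graded_poset (principal_ideal ?R x)" if "x \<in> ?R" for x
      using that graded_principal_ideal[OF P] principal_ideal_order_ideal[OF R(2)] by auto
    fix x assume x: "x \<in> ?R" and max: "\<And>y. y \<in> ?R \<Longrightarrow> x \<le> y \<Longrightarrow> y = x"
    obtain q where q: "q \<in> J" "f x \<le> q" "\<And>y. y \<in> J \<Longrightarrow> q \<le> y \<Longrightarrow> q = y"
      using finite_has_maximal2[OF finJ, of "f x"] x by auto
    let ?F = "P \<inter> f -` principal_ideal Q q"
    have qQ: "q \<in> Q" using q JQ by blast
    have "order_ideal Q (principal_ideal Q q)"
      by (auto simp: order_ideal_def principal_ideal_def)
    then have F: "finite ?F" "order_ideal P ?F" "graded_poset ?F"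
      using P order_ideal_vimage[OF f(1,2)] fib[OF qQ] by auto
    have FR: "?F \<subseteq> ?R"
      using J(1) q(1) by (auto simp: order_ideal_def principal_ideal_def)
    \<comment> \<open>The fiber \<open>?F\<close> is an order ideal of \<open>P\<close>, so its
      element ranks are those of \<open>P\<close>, which \<open>f\<close> carries to
      \<open>Q\<close>.\<close>
    have rank: "element_rank ?F y = element_rank Q (f y)" if "y \<in> ?F" for y
      using that f(3) principal_ideal_order_ideal[OF F(2) that]
      by (auto simp: rank_preserving_def element_rank_def)
    have xF: "x \<in> ?F" using x q(2) JQ by (auto simp: principal_ideal_def)
    have xrank: "element_rank ?F x = poset_rank ?F"
      by (rule element_rank_maximal[OF F(1,3) xF]) (use FR max in blast)
    obtain w where w: "w \<in> P" "f w = q" using qQ f(2) by blast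
    then have wF: "w \<in> ?F" using qQ by (auto simp: principal_ideal_def)
    \<comment> \<open>Passing to a maximal element \<open>y\<close> above \<open>w\<close> keeps the
      image: \<open>f y\<close> lies between \<open>f w = q\<close> and the top \<open>q\<close> of
      the ideal.\<close>
    obtain y where y: "y \<in> ?F" "w \<le> y" "\<And>z. z \<in> ?F \<Longrightarrow> y \<le> z \<Longrightarrow> y = z"
      using finite_has_maximal2[OF F(1) wF] by auto
    have "f w \<le> f y" using mono_onD[OF f(1)] w y by blast
    moreover have "f y \<le> q" using y(1) by (auto simp: principal_ideal_def)
    ultimately have fy: "f y = q" using w(2) by auto
    have yrank: "element_rank ?F y = poset_rank ?F"
      by (rule element_rank_maximal[OF F(1,3) y(1)]) (use y(3) in metis)
    have "element_rank ?R x = element_rank ?F x"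
      using principal_ideal_order_ideal[OF R(2) x] principal_ideal_order_ideal[OF F(2) xF]
      by (simp add: element_rank_def)
    also have "\<dots> = element_rank Q q"
      using xrank yrank rank[OF y(1)] fy by simp
    also have "\<dots> = element_rank J q"
      using principal_ideal_order_ideal[OF J(1) q(1)] by (simp add: element_rank_def)
    also have "\<dots> = poset_rank J"
      by (rule element_rank_maximal[OF finJ J(2) q(1)]) (use q(3) in metis)
    finally show "element_rank ?R x = poset_rank J" .
  qed
  show "graded_poset ?R" by (rule graded_posetI[OF R(1) length])
  show "poset_rank ?R = poset_rank J" by (rule poset_rank_eqI[OF R(1) length])
qed

text \<open>A rank-preserving map preserves and reflects minimality of elements, so all minimal elements
  of \<open>P\<close> lie in the fiber over the minimum of \<open>Q\<close>.\<close>

lemma has_minimum_rank_preserving: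
  assumes P: "finite P" "graded_poset P" and Q: "finite Q" "graded_poset Q" "has_minimum Q"
    and f: "f ` P = Q" "rank_preserving P Q f"
    and fib: "\<And>q. q \<in> Q \<Longrightarrow> has_minimum (P \<inter> f -` principal_ideal Q q)"
  shows "has_minimum P"
proof -
  obtain m where m: "m \<in> Q" "\<And>q. q \<in> Q \<Longrightarrow> m \<le> q"
    using Q(3) unfolding has_minimum_def by blast
  \<comment> \<open>The ideal of \<open>m\<close> is \<open>m\<close> alone, so the fiber over it
    consists of the elements mapped to \<open>m\<close>, and \<open>b\<close> is its
    minimum.\<close>
  obtain b where b: "b \<in> P" "\<And>x. x \<in> P \<Longrightarrow> f x = m \<Longrightarrow> b \<le> x"
    using fib[OF m(1)] m(1) unfolding has_minimum_def principal_ideal_def by auto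
  have "b \<le> x" if "x \<in> P" for x
  proof -
    obtain z where z: "z \<in> P" "z \<le> x" "\<And>y. y \<in> P \<Longrightarrow> y \<le> z \<Longrightarrow> z = y"
      using finite_has_minimal2[OF P(1) \<open>x \<in> P\<close>] by auto
    have "element_rank P z = 0"
      using element_rank_eq_0_iff[OF P z(1)] z(3) by metis
    then have "element_rank Q (f z) = 0"
      using f(2) z(1) by (simp add: rank_preserving_def)
    then have "f z = m"
      using element_rank_eq_0_iff[OF Q(1,2), of "f z"] f(1) z(1) m by (metis imageI)
    then have "b \<le> z" using b(2) z(1) by blast
    then show ?thesis using z(2) by order
  qed
  then show ?thesis using b(1) unfolding has_minimum_def by blast
qed

theorem theorem3p7:
  fixes P :: "'a::order set" and Q :: "'b::order set" and f :: "'a \<Rightarrow> 'b"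
  assumes "finite P" and "graded_poset P"
    and "finite Q" and "graded_poset Q"
    and "mono_on P f" and "f ` P = Q" and "rank_preserving P Q f"
    and "\<And>q. q \<in> Q \<Longrightarrow> strongly_constructible (P \<inter> f -` principal_ideal Q q)"
    and "strongly_constructible Q"
  shows "strongly_constructible P"
  using assms(9,1-8)
\<comment> \<open>\<open>P\<close> is generalized because the induction hypotheses are applied to
  preimages of ideals; \<open>f\<close> stays fixed.\<close>
proof (induction arbitrary: P rule: strongly_constructible.induct)
  case (bounded_shellable Q P)
  then obtain q where q: "q \<in> Q" "\<And>x. x \<in> Q \<Longrightarrow> x \<le> q"
    unfolding bounded_poset_def has_maximum_def by blast
  then have "P \<inter> f -` principal_ideal Q q = P"
    using \<open>f ` P = Q\<close> by (auto simp: principal_ideal_def)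
  then show ?case using bounded_shellable.prems(8)[OF q(1)] by simp
next
  case (ideal_union Q J1 J2 P)
  note prems = ideal_union.prems
  have fib: "graded_poset (P \<inter> f -` principal_ideal Q q)"
    "has_minimum (P \<inter> f -` principal_ideal Q q)" if "q \<in> Q" for q
    using prems(8)[OF that] strongly_constructible_graded strongly_constructible_has_minimum
    by blast+
  \<comment> \<open>The induction hypothesis enters as the assumption \<open>IH\<close>, so that one
    argument serves \<open>J1\<close>, \<open>J2\<close> and \<open>J1 \<inter> J2\<close>.\<close>
  have preimage: "poset_rank (P \<inter> f -` J) = poset_rank J \<and> strongly_constructible (P \<inter> f -` J)"
    if J: "order_ideal Q J" "strongly_constructible J"
      and IH: "\<And>P. \<lbrakk>finite P; graded_poset P; finite J; graded_poset J; mono_on P f; f ` P = J;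
        rank_preserving P J f;
        \<And>q. q \<in> J \<Longrightarrow> strongly_constructible (P \<inter> f -` principal_ideal J q)\<rbrakk>
        \<Longrightarrow> strongly_constructible P" for J
  proof -
    let ?R = "P \<inter> f -` J"
    have JQ: "J \<subseteq> Q" using J by (simp add: order_ideal_def)
    have graded: "graded_poset J" using J(2) by (rule strongly_constructible_graded)
    have "J \<noteq> {}"
      using strongly_constructible_has_minimum[OF J(2)] by (auto simp: has_minimum_def)
    then have R: "graded_poset ?R" "poset_rank ?R = poset_rank J"
      using vimage_order_ideal_rank[OF prems(1-3) prems(5-7) fib(1) J(1) graded] by auto
    have "strongly_constructible ?R"
    proof (rule IH)
      show "finite ?R" "finite J" using prems(1,3) JQ finite_subset by auto
      show "graded_poset ?R" "graded_poset J" by fact+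
      show "mono_on ?R f" using prems(5) mono_on_subset by blast
      show "f ` ?R = J" using prems(6) JQ by auto
      have "order_ideal P ?R" by (rule order_ideal_vimage[OF prems(5,6) J(1)])
      then show "rank_preserving ?R J f"
        using prems(7) principal_ideal_order_ideal[of P ?R] principal_ideal_order_ideal[OF J(1)]
        by (auto simp: rank_preserving_def element_rank_def)
      show "strongly_constructible (?R \<inter> f -` principal_ideal J q)" if "q \<in> J" for q
      proof -
        \<comment> \<open>Below \<open>q\<close> the ideal \<open>J\<close> contains all of
          \<open>Q\<close>, so the fibers of the restricted map are fibers of
          \<open>f\<close>.\<close>
        have "?R \<inter> f -` principal_ideal J q = P \<inter> f -` principal_ideal Q q"
          using J(1) that by (auto simp: order_ideal_def principal_ideal_def)
        then show ?thesis using prems(8)[of q] that JQ by auto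
      qed
    qed
    with R show ?thesis by blast
  qed
  have inter: "order_ideal Q (J1 \<inter> J2)"
    using \<open>order_ideal Q J1\<close> \<open>order_ideal Q J2\<close> by (auto simp: order_ideal_def)
  have R1: "poset_rank (P \<inter> f -` J1) = poset_rank J1" "strongly_constructible (P \<inter> f -` J1)"
    using preimage[OF \<open>order_ideal Q J1\<close> \<open>strongly_constructible J1\<close>] ideal_union.IH(1)
    by blast+
  have R2: "poset_rank (P \<inter> f -` J2) = poset_rank J2" "strongly_constructible (P \<inter> f -` J2)"
    using preimage[OF \<open>order_ideal Q J2\<close> \<open>strongly_constructible J2\<close>] ideal_union.IH(2)
    by blast+
  have R12: "poset_rank (P \<inter> f -` (J1 \<inter> J2)) = poset_rank (J1 \<inter> J2)"
    "strongly_constructible (P \<inter> f -` (J1 \<inter> J2))"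
    using preimage[OF inter \<open>strongly_constructible (J1 \<inter> J2)\<close>] ideal_union.IH(3)
    by blast+
  have eq: "(P \<inter> f -` J1) \<inter> (P \<inter> f -` J2) = P \<inter> f -` (J1 \<inter> J2)" by blast
  \<comment> \<open>For \<open>J = Q\<close> the preimage is \<open>P\<close> itself, which gives
    \<open>P\<close> and \<open>Q\<close> the same rank.\<close>
  have PQ: "P \<inter> f -` Q = P" using prems(6) by blast
  have "Q \<noteq> {}" using \<open>has_minimum Q\<close> by (auto simp: has_minimum_def)
  moreover have "order_ideal Q Q" by (simp add: order_ideal_def)
  ultimately have rank: "poset_rank P = poset_rank Q"
    using vimage_order_ideal_rank(2)[OF prems(1-3) prems(5-7) fib(1) _ prems(4)] PQ by simp
  have minP: "has_minimum P"
    by (rule has_minimum_rank_preserving[OF prems(1-4) \<open>has_minimum Q\<close> prems(6,7) fib(2)])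
  \<comment> \<open>By surjectivity the preimage of a proper ideal misses an element of
    \<open>P\<close>.\<close>
  have ne: "P \<inter> f -` J \<noteq> P" if "order_ideal Q J" "J \<noteq> Q" for J
    using that prems(6) unfolding order_ideal_def by blast
  show ?case
  proof (rule strongly_constructible.ideal_union[of P "P \<inter> f -` J1" "P \<inter> f -` J2"])
    show "order_ideal P (P \<inter> f -` J1)" "order_ideal P (P \<inter> f -` J2)"
      using order_ideal_vimage[OF prems(5,6)] ideal_union.hyps by blast+
    show "P = P \<inter> f -` J1 \<union> P \<inter> f -` J2"
      using PQ \<open>Q = J1 \<union> J2\<close> by blast
    show "P \<inter> f -` J1 \<noteq> P" "P \<inter> f -` J2 \<noteq> P"
      using ne ideal_union.hyps by blast+
  \<comment> \<open>All ranks on the side of \<open>P\<close> equal those on the side of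
    \<open>Q\<close>, so the rank conditions carry over.\<close>
  qed (use R1 R2 R12 rank minP prems(2) ideal_union.hyps in \<open>simp_all add: eq\<close>)
qed

end
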